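(* Let $E$ be a Banach space and let $\psi$ be a measure of noncompactness on subsets of $E$ equivalent to the Hausdorff measure of noncompactness $\chi$. (i) Let $f\colon E\to E$ be a continuous operator which has a continuous (i.e. bounded linear) Fréchet derivative $f'(u_1)$ at a point $u_1\in E$. Then the following are equivalent: (a) $f\in(\lambda_1)$, i.e. $f'(u_1)$ is completely continuous; (b) $f\in(\lambda_2)$, i.e. $f$ is locally strongly $\psi$-condensing at $u_1$; (c) $f\in(\lambda_3)$, i.e. $f$ is locally strongly $\psi$-condensing at $u_1$ on spheres. (ii) Let $f\colon E\to E$ be a continuous asymptotically linear operator with asymptotic derivative $f'(\infty)$. Then the following are equivalent: (a) $f\in(\tilde\lambda_1)$, i.e. $f'(\infty)$ is completely continuous; (b) $f\in(\tilde\lambda_2)$, i.e. $f$ is strongly $\psi$-condensing at infinity on spherical interlayers; (c) $f\in(\tilde\lambda_3)$, i.e. $f$ is strongly $\psi$-condensing at infinity on spheres.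
   Context: Notation: $S_\rho=\{u\in E:\|u\|=\rho\}$, $B_\rho=\{u\in E:\|u\|\leqslant\rho\}$. The Hausdorff measure of noncompactness $\chi(U)$ of $U\subset E$ is the infimum of the numbers $\varepsilon>0$ such that $U$ has a finite $\varepsilon$-net in $E$ (so $\chi(U)=+\infty$ if $U$ is unbounded). A set function $\psi$ is equivalent to $\chi$ if there are constants $c_1,c_2>0$ with $c_1\chi(U)\leqslant\psi(U)\leqslant c_2\chi(U)$ for all $U\subset E$. $f$ is (Fréchet) differentiable at $u_1$ if there is a bounded linear operator $f'(u_1)$ with $f(u_1+u)-f(u_1)=f'(u_1)u+\omega(u)$, where $\|\omega(u)\|/\|u\|\to0$ as $\|u\|\to0$. $f$ is asymptotically linear if there is a bounded linear operator $f'(\infty)$ (the asymptotic derivative, or derivative at $\infty$) with $f(u)=f'(\infty)u+\tilde\omega(u)$, where $\|\tilde\omega(u)\|/\|u\|\to0$ as $\|u\|\to\infty$. An operator is completely continuous if it is continuous and compact (maps bounded sets to relatively compact sets). Classes of continuous operators $f\colon E\to E$: Locally strongly $\psi$-condensing at $u_1\in E$ (class $(\lambda_2)$): there exist $r_1>0$ and a nonnegative function $\lambda_{u_1,f}$ on $[0,r_1]$ with $\lim_{r\to0}\lambda_{u_1,f}(r)=0$ such that $\psi(f(U))\leqslant\lambda_{u_1,f}(r)\,\psi(U)$ for all $0<\rho<r<r_1$ and $U=u_1+B_\rho$. Locally strongly $\psi$-condensing at $u_1$ on spheres (class $(\lambda_3)$): the same with $U=u_1+S_\rho$ instead of $U=u_1+B_\rho$.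 Strongly $\psi$-condensing at infinity on spherical interlayers (class $(\tilde\lambda_2)$): there exist $R_f>0$ and a nonnegative function $\tilde\lambda_f$ on $[R_f,\infty)$ with $\lim_{r\to\infty}\tilde\lambda_f(r)=0$ such that $\psi(f(U))\leqslant\tilde\lambda_f(R_1)\,\psi(U)$ for all $R_2>R_1>R_f$ and $U=B_{R_2}\setminus B_{R_1}$. Strongly $\psi$-condensing at infinity on spheres (class $(\tilde\lambda_3)$): the same with $U=S_{R_2}$ instead of $U=B_{R_2}\setminus B_{R_1}$. The only requirement on the measure of noncompactness $\psi$ is that it is a set function equivalent to $\chi$. *)

theory Defs
  imports "HOL-Analysis.Analysis"
begin

text \<open>The centres of the net range over the whole space, not over \<open>U\<close>. The infimum of the
  empty set is \<open>\<infinity>\<close>, so unbounded sets have measure \<open>\<infinity>\<close>.\<close>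

definition hausdorff_mnc :: "'a::metric_space set \<Rightarrow> ennreal" where
  "hausdorff_mnc U =
     Inf {ennreal \<epsilon> | \<epsilon>. \<epsilon> > 0 \<and> (\<exists>F. finite F \<and> (\<forall>u\<in>U. \<exists>x\<in>F. dist u x \<le> \<epsilon>))}"

text \<open>Nothing else (monotonicity, subadditivity, invariance under convex hulls, etc.) is
  required of \<open>\<psi>\<close>.\<close>

definition equivalent_mnc :: "('a::metric_space set \<Rightarrow> ennreal) \<Rightarrow> bool" where
  "equivalent_mnc \<psi> \<longleftrightarrow>
     (\<exists>c1 c2::real. c1 > 0 \<and> c2 > 0 \<and>
        (\<forall>U. ennreal c1 * hausdorff_mnc U \<le> \<psi> U \<and> \<psi> U \<le> ennreal c2 * hausdorff_mnc U))"

definition completely_continuous :: "('a::metric_space \<Rightarrow> 'b::metric_space) \<Rightarrow> bool" where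
  "completely_continuous g \<longleftrightarrow>
     continuous_on UNIV g \<and> (\<forall>B. bounded B \<longrightarrow> compact (closure (g ` B)))"

definition has_asymptotic_derivative ::
    "('a::real_normed_vector \<Rightarrow> 'b::real_normed_vector) \<Rightarrow> ('a \<Rightarrow> 'b) \<Rightarrow> bool" where
  "has_asymptotic_derivative f A \<longleftrightarrow>
     bounded_linear A \<and> ((\<lambda>u. norm (f u - A u) / norm u) \<longlongrightarrow> 0) at_infinity"

text \<open>In the following definitions the comparison function \<open>l\<close> matters only on the stated
  interval; its values elsewhere are irrelevant.\<close>

definition loc_strongly_condensing ::
    "('a::real_normed_vector set \<Rightarrow> ennreal) \<Rightarrow> ('a \<Rightarrow> 'a) \<Rightarrow> 'a \<Rightarrow> bool" where
  "loc_strongly_condensing \<psi> f u1 \<longleftrightarrow>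
     (\<exists>r1 > 0. \<exists>l :: real \<Rightarrow> real.
        (\<forall>r\<in>{0..r1}. l r \<ge> 0) \<and> (l \<longlongrightarrow> 0) (at 0 within {0..r1}) \<and>
        (\<forall>\<rho> r. 0 < \<rho> \<and> \<rho> < r \<and> r < r1 \<longrightarrow>
           \<psi> (f ` cball u1 \<rho>) \<le> ennreal (l r) * \<psi> (cball u1 \<rho>)))"

definition loc_strongly_condensing_on_spheres ::
    "('a::real_normed_vector set \<Rightarrow> ennreal) \<Rightarrow> ('a \<Rightarrow> 'a) \<Rightarrow> 'a \<Rightarrow> bool" where
  "loc_strongly_condensing_on_spheres \<psi> f u1 \<longleftrightarrow>
     (\<exists>r1 > 0. \<exists>l :: real \<Rightarrow> real.
        (\<forall>r\<in>{0..r1}. l r \<ge> 0) \<and> (l \<longlongrightarrow> 0) (at 0 within {0..r1}) \<and>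
        (\<forall>\<rho> r. 0 < \<rho> \<and> \<rho> < r \<and> r < r1 \<longrightarrow>
           \<psi> (f ` sphere u1 \<rho>) \<le> ennreal (l r) * \<psi> (sphere u1 \<rho>)))"

definition strongly_condensing_at_infinity_on_interlayers ::
    "('a::real_normed_vector set \<Rightarrow> ennreal) \<Rightarrow> ('a \<Rightarrow> 'a) \<Rightarrow> bool" where
  "strongly_condensing_at_infinity_on_interlayers \<psi> f \<longleftrightarrow>
     (\<exists>Rf > 0. \<exists>l :: real \<Rightarrow> real.
        (\<forall>R\<ge>Rf. l R \<ge> 0) \<and> (l \<longlongrightarrow> 0) at_top \<and>
        (\<forall>R1 R2. Rf < R1 \<and> R1 < R2 \<longrightarrow>
           \<psi> (f ` (cball 0 R2 - cball 0 R1)) \<le> ennreal (l R1) * \<psi> (cball 0 R2 - cball 0 R1)))"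

definition strongly_condensing_at_infinity_on_spheres ::
    "('a::real_normed_vector set \<Rightarrow> ennreal) \<Rightarrow> ('a \<Rightarrow> 'a) \<Rightarrow> bool" where
  "strongly_condensing_at_infinity_on_spheres \<psi> f \<longleftrightarrow>
     (\<exists>Rf > 0. \<exists>l :: real \<Rightarrow> real.
        (\<forall>R\<ge>Rf. l R \<ge> 0) \<and> (l \<longlongrightarrow> 0) at_top \<and>
        (\<forall>R1 R2. Rf < R1 \<and> R1 < R2 \<longrightarrow>
           \<psi> (f ` sphere 0 R2) \<le> ennreal (l R1) * \<psi> (sphere 0 R2)))"

end

theory Submission
  imports Defs
begin

text \<open>Let \<open>A\<close> be the derivative and let \<open>U\<close> be a set with
  \<open>sphere a \<rho> \<subseteq> U \<subseteq> cball a \<rho>\<close> on which \<open>f\<close> is within \<open>\<eta> * \<rho>\<close> of an affine map with linear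
  part \<open>A\<close>. Then \<open>\<chi> (f ` U)\<close> and \<open>\<chi> (A ` U)\<close> differ by at most \<open>\<eta> * \<rho>\<close>, while \<open>\<chi> U \<le> \<rho>\<close>.
  If \<open>A\<close> is compact, this gives \<open>\<chi> (f ` U) \<le> \<eta> * \<rho>\<close>, and either the space is locally compact, so
  that every measure involved vanishes, or \<open>\<chi> U \<ge> \<kappa> * \<rho>\<close> for a constant \<open>\<kappa> > 0\<close>.
  Conversely, if \<open>f\<close> is condensing with constant \<open>l\<close> on \<open>U\<close>, rescaling to the unit sphere \<open>S\<close>
  bounds \<open>\<chi> (A ` S)\<close> by a quantity of order \<open>l + \<eta>\<close>, which tends to \<open>0\<close>. Balls, spheres and
  spherical interlayers are all instances of \<open>U\<close>.\<close>

section \<open>Finite nets and the Hausdorff measure of noncompactness\<close>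

definition finite_net :: "real \<Rightarrow> 'a::metric_space set \<Rightarrow> bool" where
  "finite_net e U \<longleftrightarrow> (\<exists>F. finite F \<and> (\<forall>u\<in>U. \<exists>x\<in>F. dist u x \<le> e))"

lemma finite_net_mono: "finite_net e V \<Longrightarrow> U \<subseteq> V \<Longrightarrow> e \<le> e' \<Longrightarrow> finite_net e' U"
  unfolding finite_net_def by (meson order_trans subsetD)

lemma hausdorff_mnc_eq: "hausdorff_mnc U = Inf {ennreal e | e. e > 0 \<and> finite_net e U}"
  unfolding hausdorff_mnc_def finite_net_def ..

text \<open>Radii strictly above \<open>e\<close> suffice because the measure is an infimum. This
  form also covers \<open>e = 0\<close>, although only positive radii enter the infimum.\<close>

lemma hausdorff_mnc_le:
  assumes "0 \<le> e" and net: "\<And>d. d > e \<Longrightarrow> finite_net d U"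
  shows "hausdorff_mnc U \<le> ennreal e"
proof (rule ennreal_le_epsilon)
  fix d :: real
  assume "0 < d"
  have "ennreal (e + d) \<in> {ennreal e | e. e > 0 \<and> finite_net e U}"
    using \<open>0 \<le> e\<close> \<open>0 < d\<close> net[of "e + d"] by (intro CollectI exI[of _ "e + d"]) simp
  then have "hausdorff_mnc U \<le> ennreal (e + d)"
    unfolding hausdorff_mnc_eq by (rule Inf_lower)
  then show "hausdorff_mnc U \<le> ennreal e + ennreal d"
    using \<open>0 < d\<close> \<open>0 \<le> e\<close> by simp
qed

text \<open>Strict inequality provides an admissible radius below \<open>e\<close>, and nets survive
  enlarging the radius. With equality the infimum might not be attained.\<close>

lemma finite_net_if_hausdorff_mnc_less:
  assumes "hausdorff_mnc U < ennreal e"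
  shows "finite_net e U"
proof -
  obtain d where "ennreal d < ennreal e" "d > 0" "finite_net d U"
    using assms unfolding hausdorff_mnc_eq Inf_less_iff by auto
  then show ?thesis
    by (metis ennreal_less_iff finite_net_mono less_imp_le order_refl)
qed

text \<open>In a complete space a closed set is compact iff it is totally bounded. Passing from
  \<open>U\<close> to its closure is possible because a finite union of closed balls is closed;
  taking half the radius then leaves room for open balls.\<close>

lemma compact_closure_iff_finite_net:
  fixes U :: "'a::complete_space set"
  shows "compact (closure U) \<longleftrightarrow> (\<forall>e>0. finite_net e U)"
proof
  assume "compact (closure U)"
  then have tb: "\<forall>e>0. \<exists>k. finite k \<and> closure U \<subseteq> (\<Union>x\<in>k. ball x e)"
    unfolding compact_eq_totally_bounded by blast
  show "\<forall>e>0. finite_net e U"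
  proof (intro allI impI)
    fix e :: real
    assume "0 < e"
    then obtain k where k: "finite k" "closure U \<subseteq> (\<Union>x\<in>k. ball x e)"
      using tb by blast
    have "\<exists>x\<in>k. dist u x \<le> e" if "u \<in> U" for u
    proof -
      have "u \<in> (\<Union>x\<in>k. ball x e)"
        using that k(2) closure_subset by blast
      then show ?thesis
        by (auto simp: dist_commute intro: less_imp_le)
    qed
    then show "finite_net e U"
      unfolding finite_net_def using k(1) by blast
  qed
next
  assume net: "\<forall>e>0. finite_net e U"
  have "\<exists>k. finite k \<and> closure U \<subseteq> (\<Union>x\<in>k. ball x e)" if "0 < e" for e
  proof -
    obtain F where F: "finite F" "\<forall>u\<in>U. \<exists>x\<in>F. dist u x \<le> e / 2"
      using net \<open>0 < e\<close> unfolding finite_net_def by (meson half_gt_zero)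
    have "closure U \<subseteq> (\<Union>x\<in>F. cball x (e / 2))"
    proof (rule closure_minimal)
      show "U \<subseteq> (\<Union>x\<in>F. cball x (e / 2))"
        using F(2) by (fastforce simp: dist_commute)
      show "closed (\<Union>x\<in>F. cball x (e / 2))"
        using F(1) by (intro closed_UN) auto
    qed
    also have "\<dots> \<subseteq> (\<Union>x\<in>F. ball x e)"
      using \<open>0 < e\<close> by fastforce
    finally show ?thesis
      using F(1) by blast
  qed
  then show "compact (closure U)"
    unfolding compact_eq_totally_bounded by (simp add: complete_eq_closed)
qed

lemma hausdorff_mnc_subset_compact:
  fixes K :: "'a::complete_space set"
  assumes "compact K" "U \<subseteq> K"
  shows "hausdorff_mnc U = 0"
proof -
  have "\<forall>e>0. finite_net e K"
    using assms(1) by (simp add: compact_closure_iff_finite_net[symmetric] compact_imp_closed)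
  then have "hausdorff_mnc U \<le> ennreal 0"
    using finite_net_mono[OF _ assms(2) order_refl] by (intro hausdorff_mnc_le) auto
  then show ?thesis
    by simp
qed

text \<open>The centre \<open>a\<close> alone is a net.\<close>

lemma hausdorff_mnc_cball_le:
  assumes "U \<subseteq> cball a \<rho>" "0 \<le> \<rho>"
  shows "hausdorff_mnc U \<le> ennreal \<rho>"
  using assms
  by (intro hausdorff_mnc_le) (auto simp: finite_net_def dist_commute subset_iff intro!: exI[of _ "{a}"]
      intro: order_trans less_imp_le)

section \<open>Rescaling to the unit sphere, and cones over compact sets\<close>

lemma sphere_scaleR:
  fixes v :: "'a::real_normed_vector"
  assumes "v \<in> sphere 0 1" "0 \<le> \<rho>"
  shows "a + \<rho> *\<^sub>R v \<in> sphere a \<rho>"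
  using assms by (simp add: dist_norm)

text \<open>Translation and dilation carry nets to nets and multiply radii by the dilation factor.
  Read contrapositively, it bounds from below the measure of every set containing a sphere,
  proportionally to the radius.\<close>

lemma finite_net_unit_sphere:
  fixes a :: "'a::real_normed_vector"
  assumes "finite_net (\<kappa> * \<rho>) (sphere a \<rho>)" "0 < \<rho>"
  shows "finite_net \<kappa> (sphere (0::'a) 1)"
proof -
  obtain F where F: "finite F" "\<forall>u\<in>sphere a \<rho>. \<exists>x\<in>F. dist u x \<le> \<kappa> * \<rho>"
    using assms(1) unfolding finite_net_def by blast
  have "\<exists>y\<in>(\<lambda>x. (x - a) /\<^sub>R \<rho>) ` F. dist v y \<le> \<kappa>" if v: "v \<in> sphere 0 1" for v
  proof -
    obtain x where x: "x \<in> F" "dist (a + \<rho> *\<^sub>R v) x \<le> \<kappa> * \<rho>"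
      using F(2) sphere_scaleR[OF v] \<open>0 < \<rho>\<close> by (meson less_imp_le)
    have "a + \<rho> *\<^sub>R v - x = \<rho> *\<^sub>R (v - (x - a) /\<^sub>R \<rho>)"
      using \<open>0 < \<rho>\<close> by (simp add: algebra_simps)
    then have "\<rho> * dist v ((x - a) /\<^sub>R \<rho>) \<le> \<kappa> * \<rho>"
      using x(2) \<open>0 < \<rho>\<close> by (simp add: dist_norm)
    then have "dist v ((x - a) /\<^sub>R \<rho>) \<le> \<kappa>"
      using \<open>0 < \<rho>\<close> by (simp add: mult.commute)
    then show ?thesis
      using x(1) by blast
  qed
  then show ?thesis
    unfolding finite_net_def using F(1) by (metis finite_imageI)
qed

lemma compact_cone:
  fixes K :: "'a::real_normed_vector set"
  assumes "compact K"
  shows "compact ((\<lambda>(t, x). t *\<^sub>R x) ` ({0..M} \<times> K))"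
  by (intro compact_continuous_image compact_Times assms compact_Icc)
    (auto simp: case_prod_unfold intro!: continuous_intros)

text \<open>Polar decomposition of a vector into norm and direction. The point 0 has no direction
  and is inserted separately; in the zero space the unit sphere is even empty.\<close>

lemma bounded_subset_cone:
  fixes B :: "'a::real_normed_vector set"
  assumes "bounded B"
  obtains M where "B \<subseteq> insert 0 ((\<lambda>(t, x). t *\<^sub>R x) ` ({0..M} \<times> sphere 0 1))"
proof -
  obtain M where M: "\<forall>x\<in>B. norm x \<le> M"
    using assms unfolding bounded_iff by blast
  have "x \<in> insert 0 ((\<lambda>(t, x). t *\<^sub>R x) ` ({0..M} \<times> sphere 0 1))" if "x \<in> B" for x
  proof (cases "x = 0")
    case False
    then have "x = norm x *\<^sub>R (x /\<^sub>R norm x)" "x /\<^sub>R norm x \<in> sphere 0 1"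
      by (auto simp: dist_norm)
    then show ?thesis
      using M that by (intro insertI2 image_eqI[where x = "(norm x, x /\<^sub>R norm x)"]) auto
  qed simp
  then show thesis
    using that by blast
qed

text \<open>The unit sphere is closed, hence compact once it is totally bounded. A ball is then a
  closed subset of a compact cone over it.\<close>

lemma compact_cball_if_finite_net_sphere:
  fixes a :: "'a::banach"
  assumes "\<And>e. e > 0 \<Longrightarrow> finite_net e (sphere (0::'a) 1)"
  shows "compact (cball a \<rho>)"
proof -
  have "closed (cball (0::'a) 1 - ball 0 1)"
    by (intro closed_Diff) auto
  also have "cball (0::'a) 1 - ball 0 1 = sphere 0 1"
    by auto
  finally have K: "compact (sphere (0::'a) 1)"
    using assms compact_closure_iff_finite_net[of "sphere (0::'a) 1"]
    by (simp add: closure_closed)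
  obtain M where "cball a \<rho> \<subseteq> insert 0 ((\<lambda>(t, x). t *\<^sub>R x) ` ({0..M} \<times> sphere 0 1))"
    using bounded_subset_cone[OF bounded_cball] by blast
  then show ?thesis
    using compact_cone[OF K, of M] by (metis compact_insert closed_cball closed_Int_compact inf.absorb1)
qed

lemma completely_continuous_if_finite_net_sphere:
  fixes A :: "'a::real_normed_vector \<Rightarrow> 'b::banach"
  assumes A: "bounded_linear A" and net: "\<And>e. e > 0 \<Longrightarrow> finite_net e (A ` sphere 0 1)"
  shows "completely_continuous A"
proof -
  interpret bounded_linear A by (fact A)
  define K where "K = closure (A ` sphere 0 1)"
  have K: "compact K"
    unfolding K_def compact_closure_iff_finite_net using net by blast
  have "compact (closure (A ` B))" if "bounded B" for B
  proof -
    obtain M where M: "B \<subseteq> insert 0 ((\<lambda>(t, x). t *\<^sub>R x) ` ({0..M} \<times> sphere 0 1))"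
      using bounded_subset_cone[OF \<open>bounded B\<close>] by blast
    have "A x \<in> insert 0 ((\<lambda>(t, x). t *\<^sub>R x) ` ({0..M} \<times> K))" if "x \<in> B" for x
    proof (cases "x = 0")
      case False
      then obtain t v where "t \<in> {0..M}" "v \<in> sphere 0 1" "x = t *\<^sub>R v"
        using M \<open>x \<in> B\<close> by auto
      moreover from this have "A v \<in> K"
        unfolding K_def by (intro subsetD[OF closure_subset] imageI)
      ultimately show ?thesis
        by (intro insertI2 image_eqI[where x = "(t, A v)"]) (simp_all add: scaleR)
    qed (simp add: zero)
    then have AB: "A ` B \<subseteq> insert 0 ((\<lambda>(t, x). t *\<^sub>R x) ` ({0..M} \<times> K))" (is "_ \<subseteq> ?C")
      by (rule image_subsetI)
    have C: "compact ?C"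
      by (intro compact_insert compact_cone K)
    have "closure (A ` B) \<subseteq> ?C"
      using AB C by (intro closure_minimal compact_imp_closed)
    then have "closure (A ` B) = closure (A ` B) \<inter> ?C"
      by blast
    then show ?thesis
      using closed_Int_compact[OF closed_closure C, of "A ` B"] by simp
  qed
  then show ?thesis
    unfolding completely_continuous_def
    using linear_continuous_on[OF A] by blast
qed

section \<open>Estimates relating the map to its linear part, and comparison functions\<close>

text \<open>The constant \<open>K\<close> depends on \<open>\<psi>\<close> and the space only, and
  is fixed before the map, the set and the scale. Therefore an approximation error
  \<open>\<eta>\<close> tending to 0 forces the condensing constant to 0 as well.\<close>

lemma condensing_if_completely_continuous:
  fixes A :: "'a::banach \<Rightarrow> 'a"
  assumes \<psi>: "equivalent_mnc \<psi>" and A: "completely_continuous A"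
  obtains K where "K > 0"
    and "\<And>f a c \<rho> \<eta> U. \<lbrakk>continuous_on UNIV f; 0 < \<rho>; 0 \<le> \<eta>; sphere a \<rho> \<subseteq> U; U \<subseteq> cball a \<rho>;
      \<And>u. u \<in> U \<Longrightarrow> norm (f u - (c + A u)) \<le> \<eta> * \<rho>\<rbrakk> \<Longrightarrow> \<psi> (f ` U) \<le> ennreal (K * \<eta>) * \<psi> U"
proof -
  obtain c1 c2 where c: "c1 > 0" "c2 > 0"
    and lower: "\<And>U. ennreal c1 * hausdorff_mnc U \<le> \<psi> U"
    and upper: "\<And>U. \<psi> U \<le> ennreal c2 * hausdorff_mnc U"
    using \<psi> unfolding equivalent_mnc_def by blast
  show thesis
  \<comment> \<open>If the unit sphere is totally bounded, then \<open>\<psi> U\<close> is 0 and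
    offers no positive lower bound; instead continuity of \<open>f\<close> on compact balls makes
    the left-hand side vanish, so any positive constant serves.\<close>
  proof (cases "\<forall>e>0. finite_net e (sphere (0::'a) 1)")
    case True
    show thesis
    proof (rule that[of 1])
      fix f :: "'a \<Rightarrow> 'a" and a c :: 'a and \<rho> \<eta> U
      assume f: "continuous_on UNIV f" and U: "U \<subseteq> cball a \<rho>"
      have "compact (f ` cball a \<rho>)"
        using True f by (intro compact_continuous_image compact_cball_if_finite_net_sphere)
          (auto intro: continuous_on_subset)
      then have "hausdorff_mnc (f ` U) = 0"
        using U by (intro hausdorff_mnc_subset_compact) auto
      then show "\<psi> (f ` U) \<le> ennreal (1 * \<eta>) * \<psi> U"
        using upper[of "f ` U"] by simp
    qed simp
  next
    case False
    then obtain \<kappa> where \<kappa>: "\<kappa> > 0" "\<not> finite_net \<kappa> (sphere (0::'a) 1)"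
      by blast
    show thesis
    proof (rule that[of "c2 / (\<kappa> * c1)"])
      fix f :: "'a \<Rightarrow> 'a" and a c :: 'a and \<rho> \<eta> U
      assume \<rho>: "0 < \<rho>" and \<eta>: "0 \<le> \<eta>" and U: "sphere a \<rho> \<subseteq> U" "U \<subseteq> cball a \<rho>"
        and close: "\<And>u. u \<in> U \<Longrightarrow> norm (f u - (c + A u)) \<le> \<eta> * \<rho>"
      have "bounded U"
        using U(2) bounded_cball bounded_subset by blast
      then have AU: "\<forall>e>0. finite_net e (A ` U)"
        using A unfolding completely_continuous_def compact_closure_iff_finite_net by blast
      \<comment> \<open>A net of \<open>A\<close> U\<open>of radius\<close>d - \<eta> *
        \<rho>\<open>, shifted by\<close>c\<open>, is a net of\<close>f \<open>U\<close> of radius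
        \<open>d\<close>.\<close>
      have fU: "hausdorff_mnc (f ` U) \<le> ennreal (\<eta> * \<rho>)"
      proof (rule hausdorff_mnc_le)
        fix d
        assume "\<eta> * \<rho> < d"
        then obtain F where F: "finite F" "\<And>u. u \<in> U \<Longrightarrow> \<exists>x\<in>F. dist (A u) x \<le> d - \<eta> * \<rho>"
          using AU[rule_format, of "d - \<eta> * \<rho>"] unfolding finite_net_def by auto
        have "\<exists>y\<in>(+) c ` F. dist (f u) y \<le> d" if u: "u \<in> U" for u
        proof -
          obtain x where x: "x \<in> F" "dist (A u) x \<le> d - \<eta> * \<rho>"
            using F(2)[OF u] by blast
          have "dist (f u) (c + x) \<le> dist (f u) (c + A u) + dist (c + A u) (c + x)"
            by (rule dist_triangle)
          also have "\<dots> \<le> d"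
            using close[OF u] x(2) by (simp add: dist_norm)
          finally show ?thesis
            using x(1) by blast
        qed
        then show "finite_net d (f ` U)"
          unfolding finite_net_def using F(1) by (intro exI[of _ "(+) c ` F"]) auto
      qed (use \<eta> \<rho> in simp)
      have "\<not> finite_net (\<kappa> * \<rho>) U"
        using finite_net_unit_sphere[of \<kappa> \<rho> a] finite_net_mono U(1) \<rho> \<kappa>(2) by blast
      then have "ennreal (\<kappa> * \<rho>) \<le> hausdorff_mnc U"
        using finite_net_if_hausdorff_mnc_less not_le by blast
      then have low: "ennreal c1 * ennreal (\<kappa> * \<rho>) \<le> \<psi> U"
        using lower[of U] mult_left_mono order_trans by (metis zero_le)
      have "\<psi> (f ` U) \<le> ennreal c2 * ennreal (\<eta> * \<rho>)"
        using upper[of "f ` U"] fU mult_left_mono order_trans by (metis zero_le)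
      \<comment> \<open>The constant is chosen so that its product with the lower bound
        \<open>c1 * \<kappa> * \<rho>\<close> is exactly \<open>c2 * \<rho>\<close>.\<close>
      also have "\<dots> = ennreal (c2 / (\<kappa> * c1) * \<eta>) * (ennreal c1 * ennreal (\<kappa> * \<rho>))"
        using c \<kappa>(1) \<rho> \<eta> by (simp add: ennreal_mult[symmetric])
      also have "\<dots> \<le> ennreal (c2 / (\<kappa> * c1) * \<eta>) * \<psi> U"
        using low by (intro mult_left_mono) auto
      finally show "\<psi> (f ` U) \<le> ennreal (c2 / (\<kappa> * c1) * \<eta>) * \<psi> U" .
    qed (use c \<kappa> in simp)
  qed
qed

lemma finite_net_derivative_sphere:
  fixes A :: "'a::banach \<Rightarrow> 'a"
  assumes \<psi>: "equivalent_mnc \<psi>" and A: "linear A"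
  obtains K where "K > 0"
    and "\<And>f a c \<rho> \<eta> l U. \<lbrakk>0 < \<rho>; 0 < \<eta>; 0 \<le> l; sphere a \<rho> \<subseteq> U; U \<subseteq> cball a \<rho>;
      \<And>u. u \<in> U \<Longrightarrow> norm (f u - (c + A u)) \<le> \<eta> * \<rho>; \<psi> (f ` U) \<le> ennreal l * \<psi> U\<rbrakk>
      \<Longrightarrow> finite_net (K * l + 2 * \<eta>) (A ` sphere 0 1)"
proof -
  interpret linear A by (fact A)
  obtain c1 c2 where c: "c1 > 0" "c2 > 0"
    and lower: "\<And>U. ennreal c1 * hausdorff_mnc U \<le> \<psi> U"
    and upper: "\<And>U. \<psi> U \<le> ennreal c2 * hausdorff_mnc U"
    using \<psi> unfolding equivalent_mnc_def by blast
  show thesis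
  proof (rule that[of "c2 / c1"])
    fix f :: "'a \<Rightarrow> 'a" and a c :: 'a and \<rho> \<eta> l U
    assume \<rho>: "0 < \<rho>" and \<eta>: "0 < \<eta>" and l: "0 \<le> l" and U: "sphere a \<rho> \<subseteq> U" "U \<subseteq> cball a \<rho>"
      and close: "\<And>u. u \<in> U \<Longrightarrow> norm (f u - (c + A u)) \<le> \<eta> * \<rho>"
      and cond: "\<psi> (f ` U) \<le> ennreal l * \<psi> U"
    let ?e = "c2 / c1 * l + \<eta>"
    have "ennreal c1 * hausdorff_mnc (f ` U) \<le> ennreal l * \<psi> U"
      using lower cond order_trans by blast
    also have "\<dots> \<le> ennreal l * (ennreal c2 * ennreal \<rho>)"
      using order_trans[OF upper mult_left_mono[OF hausdorff_mnc_cball_le[OF U(2)]]] \<rho>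
      by (intro mult_left_mono) auto
    \<comment> \<open>The summand \<open>\<eta>\<close> in \<open>?e\<close> makes this strict even
      when \<open>l = 0\<close>.\<close>
    also have "\<dots> < ennreal c1 * ennreal (?e * \<rho>)"
      using c l \<rho> \<eta> by (simp add: ennreal_mult[symmetric] ennreal_less_iff field_simps)
    finally have "hausdorff_mnc (f ` U) < ennreal (?e * \<rho>)"
      using mult_left_mono not_le by (metis zero_le)
    then obtain F where F: "finite F" "\<And>u. u \<in> U \<Longrightarrow> \<exists>x\<in>F. dist (f u) x \<le> ?e * \<rho>"
      using finite_net_if_hausdorff_mnc_less unfolding finite_net_def by (metis imageI)
    \<comment> \<open>This map sends \<open>c + A (a + \<rho> *\<^sub>R v)\<close> to
      \<open>A v\<close>.\<close>
    let ?g = "\<lambda>x. (x - (c + A a)) /\<^sub>R \<rho>"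
    have "\<exists>y\<in>?g ` F. dist (A v) y \<le> c2 / c1 * l + 2 * \<eta>" if v: "v \<in> sphere 0 1" for v
    proof -
      let ?u = "a + \<rho> *\<^sub>R v"
      have u: "?u \<in> U"
        using sphere_scaleR[OF v, of \<rho> a] \<rho> U(1) by auto
      obtain x where x: "x \<in> F" "dist (f ?u) x \<le> ?e * \<rho>"
        using F(2)[OF u] by blast
      have "\<rho> * dist (A v) (?g x) = norm (\<rho> *\<^sub>R (A v - ?g x))"
        using \<rho> by (simp add: dist_norm)
      also have "\<rho> *\<^sub>R (A v - ?g x) = c + A ?u - x"
        using \<rho> by (simp add: algebra_simps add scale)
      also have "norm \<dots> \<le> norm (c + A ?u - f ?u) + norm (f ?u - x)"
        using norm_triangle_ineq[of "c + A ?u - f ?u" "f ?u - x"] by simp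
      also have "\<dots> \<le> \<eta> * \<rho> + ?e * \<rho>"
        using close[OF u] x(2) by (simp add: dist_norm norm_minus_commute)
      also have "\<dots> = \<rho> * (c2 / c1 * l + 2 * \<eta>)"
        by (simp add: algebra_simps)
      finally show ?thesis
        using \<rho> x(1) by (auto simp del: dist_norm)
    qed
    then show "finite_net (c2 / c1 * l + 2 * \<eta>) (A ` sphere 0 1)"
      unfolding finite_net_def using F(1) by (intro exI[of _ "?g ` F"]) auto
  qed (use c in simp)
qed

text \<open>The infimum of the admissible constants need not be admissible itself, hence the positive
  summand \<open>g\<close>.\<close>

lemma comparison_function:
  fixes P :: "'b \<Rightarrow> real \<Rightarrow> bool" and g :: "'b \<Rightarrow> real"
  assumes mono: "\<And>r e e'. P r e \<Longrightarrow> e \<le> e' \<Longrightarrow> P r e'"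
    and ev: "\<And>e. e > 0 \<Longrightarrow> \<forall>\<^sub>F r in F. P r e"
    and g: "(g \<longlongrightarrow> 0) F"
  obtains l where "\<And>r. l r \<ge> 0" "(l \<longlongrightarrow> 0) F" "\<And>r. g r > 0 \<Longrightarrow> P r 1 \<Longrightarrow> P r (l r)"
proof -
  define S where "S r = {e. e > 0 \<and> P r e}" for r
  \<comment> \<open>The value 0 is a mere default where no positive constant is admissible; the
    premise \<open>P r 1\<close> of the last conclusion excludes that case.\<close>
  define l where "l r = (if S r = {} then 0 else \<bar>g r\<bar> + Inf (S r))" for r
  have bdd: "bdd_below (S r)" for r
    unfolding S_def by (auto intro: bdd_belowI[of _ 0])
  have nonneg: "Inf (S r) \<ge> 0" if "S r \<noteq> {}" for r
    using that by (intro cInf_greatest) (auto simp: S_def)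
  show thesis
  proof (rule that[of l])
    show l0: "l r \<ge> 0" for r
      unfolding l_def using nonneg by auto
    show "(l \<longlongrightarrow> 0) F"
    proof (rule tendstoI)
      fix e :: real
      assume "e > 0"
      have "\<forall>\<^sub>F r in F. P r (e / 2)"
        using ev \<open>e > 0\<close> by simp
      moreover have "\<forall>\<^sub>F r in F. dist (g r) 0 < e / 2"
        using \<open>e > 0\<close> by (intro tendstoD[OF g]) simp
      ultimately show "\<forall>\<^sub>F r in F. dist (l r) 0 < e"
      proof eventually_elim
        case (elim r)
        then have "e / 2 \<in> S r"
          using \<open>e > 0\<close> by (simp add: S_def)
        then have "Inf (S r) \<le> e / 2"
          by (intro cInf_lower bdd)
        then show ?case
          using elim(2) \<open>e > 0\<close> l0[of r] by (auto simp: l_def)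
      qed
    qed
    show "P r (l r)" if "g r > 0" "P r 1" for r
    proof -
      have "S r \<noteq> {}"
        using \<open>P r 1\<close> by (auto simp: S_def intro: exI[of _ 1])
      moreover from this have "Inf (S r) < l r"
        using \<open>g r > 0\<close> by (simp add: l_def)
      ultimately obtain e where "e \<in> S r" "e < l r"
        using cInf_lessD by blast
      then show ?thesis
        using mono by (auto simp: S_def)
    qed
  qed
qed

section \<open>The equivalences at a point and at infinity\<close>

text \<open>The family \<open>U\<close> stays abstract so that one proof serves balls and spheres,
  and the right-hand side has the shape of both definitions.\<close>

lemma completely_continuous_derivative_iff:
  fixes f :: "'a::banach \<Rightarrow> 'a"
  assumes \<psi>: "equivalent_mnc \<psi>" and f: "continuous_on UNIV f" and A: "(f has_derivative A) (at a)"
    and U: "\<And>\<rho>. 0 < \<rho> \<Longrightarrow> sphere a \<rho> \<subseteq> U \<rho>" "\<And>\<rho>. 0 < \<rho> \<Longrightarrow> U \<rho> \<subseteq> cball a \<rho>"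
  shows "completely_continuous A \<longleftrightarrow> (\<exists>r1 > 0. \<exists>l :: real \<Rightarrow> real.
        (\<forall>r\<in>{0..r1}. l r \<ge> 0) \<and> (l \<longlongrightarrow> 0) (at 0 within {0..r1}) \<and>
        (\<forall>\<rho> r. 0 < \<rho> \<and> \<rho> < r \<and> r < r1 \<longrightarrow> \<psi> (f ` U \<rho>) \<le> ennreal (l r) * \<psi> (U \<rho>)))"
    (is "_ \<longleftrightarrow> ?R")
proof -
  interpret A: bounded_linear A
    using A by (rule has_derivative_bounded_linear)
  \<comment> \<open>Differentiability, with the constant \<open>f a - A a\<close> split off so that
    the approximating map has linear part \<open>A\<close>. The error is at most
    \<open>\<eta> * \<rho>\<close> because \<open>U \<rho>\<close> lies in the ball of radius
    \<open>\<rho>\<close>.\<close>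
  have close: "\<exists>d>0. \<forall>\<rho> u. 0 < \<rho> \<and> \<rho> < d \<and> u \<in> U \<rho> \<longrightarrow> norm (f u - ((f a - A a) + A u)) \<le> \<eta> * \<rho>"
    if \<eta>: "\<eta> > 0" for \<eta>
  proof -
    obtain d where d: "d > 0" "\<And>u. norm (u - a) < d \<Longrightarrow> norm (f u - f a - A (u - a)) \<le> \<eta> * norm (u - a)"
      using A \<eta> unfolding has_derivative_at_alt by blast
    have "norm (f u - ((f a - A a) + A u)) \<le> \<eta> * \<rho>" if "0 < \<rho>" "\<rho> < d" "u \<in> U \<rho>" for \<rho> u
    proof -
      have u: "norm (u - a) \<le> \<rho>"
        using U(2)[OF that(1)] that(3) by (auto simp: dist_norm norm_minus_commute)
      have "norm (f u - ((f a - A a) + A u)) = norm (f u - f a - A (u - a))"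
        by (simp add: A.diff algebra_simps)
      also have "\<dots> \<le> \<eta> * norm (u - a)"
        using d(2) u that(2) by simp
      also have "\<dots> \<le> \<eta> * \<rho>"
        using u \<eta> by simp
      finally show ?thesis .
    qed
    then show ?thesis
      using d(1) by blast
  qed
  show ?thesis
  proof
    assume "completely_continuous A"
    then obtain K where K: "K > 0"
      and cond: "\<And>f a c \<rho> \<eta> U. \<lbrakk>continuous_on UNIV f; 0 < \<rho>; 0 \<le> \<eta>; sphere a \<rho> \<subseteq> U; U \<subseteq> cball a \<rho>;
        \<And>u. u \<in> U \<Longrightarrow> norm (f u - (c + A u)) \<le> \<eta> * \<rho>\<rbrakk> \<Longrightarrow> \<psi> (f ` U) \<le> ennreal (K * \<eta>) * \<psi> U"
      using condensing_if_completely_continuous[OF \<psi>] by metis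
    \<comment> \<open>The comparison function depends on \<open>r\<close> alone, so a constant is
      admissible only if it works for all \<open>\<rho> < r\<close> at once.\<close>
    define P where "P r e \<longleftrightarrow> (\<forall>\<rho>. 0 < \<rho> \<and> \<rho> < r \<longrightarrow> \<psi> (f ` U \<rho>) \<le> ennreal e * \<psi> (U \<rho>))" for r e
    have ex: "\<exists>d>0. \<forall>r<d. P r e" if "e > 0" for e
    proof -
      obtain d where d: "d > 0" "\<And>\<rho> u. 0 < \<rho> \<Longrightarrow> \<rho> < d \<Longrightarrow> u \<in> U \<rho> \<Longrightarrow>
          norm (f u - ((f a - A a) + A u)) \<le> e / K * \<rho>"
        using close[of "e / K"] \<open>e > 0\<close> K by auto
      have "\<psi> (f ` U \<rho>) \<le> ennreal e * \<psi> (U \<rho>)" if "0 < \<rho>" "\<rho> < d" for \<rho>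
        using cond[OF f that(1) _ U[OF that(1)] d(2)[OF that]] \<open>e > 0\<close> K by simp
      then show ?thesis
        using d(1) unfolding P_def by (meson order_less_trans)
    qed
    obtain r1 where r1: "r1 > 0" "\<forall>r<r1. P r 1"
      using ex[of 1] by auto
    \<comment> \<open>The identity serves as the positive summand: it is positive for
      \<open>r > 0\<close> and vanishes at 0. The choice of \<open>r1\<close> guarantees
      \<open>P r 1\<close> in the relevant range.\<close>
    obtain l where l: "\<And>r. l r \<ge> 0" "(l \<longlongrightarrow> 0) (at 0 within {0..r1})"
      "\<And>r. r > 0 \<Longrightarrow> P r 1 \<Longrightarrow> P r (l r)"
    proof (rule comparison_function[of P "at 0 within {0..r1}" "\<lambda>r. r"])
      show "P r e'" if "P r e" "e \<le> e'" for r e e'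
        using that unfolding P_def by (meson ennreal_leI mult_right_mono order_trans zero_le)
      show "\<forall>\<^sub>F r in at 0 within {0..r1}. P r e" if "e > 0" for e
        using ex[OF that] unfolding eventually_at by (auto simp: dist_real_def)
      show "((\<lambda>r. r) \<longlongrightarrow> 0) (at 0 within {0..r1})"
        by (rule tendsto_ident_at)
    qed blast
    have "\<psi> (f ` U \<rho>) \<le> ennreal (l r) * \<psi> (U \<rho>)" if "0 < \<rho>" "\<rho> < r" "r < r1" for \<rho> r
      using l(3)[of r] r1(2) that unfolding P_def by auto
    then show ?R
      using r1(1) l(1,2) by blast
  next
    assume ?R
    then obtain r1 l where r1: "r1 > 0" and l0: "\<And>r. r \<in> {0..r1} \<Longrightarrow> l r \<ge> 0"
      and lim: "(l \<longlongrightarrow> 0) (at 0 within {0..r1})"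
      and cond: "\<And>\<rho> r. 0 < \<rho> \<Longrightarrow> \<rho> < r \<Longrightarrow> r < r1 \<Longrightarrow> \<psi> (f ` U \<rho>) \<le> ennreal (l r) * \<psi> (U \<rho>)"
      by blast
    obtain K where K: "K > 0"
      and net: "\<And>f a c \<rho> \<eta> l U. \<lbrakk>0 < \<rho>; 0 < \<eta>; 0 \<le> l; sphere a \<rho> \<subseteq> U; U \<subseteq> cball a \<rho>;
        \<And>u. u \<in> U \<Longrightarrow> norm (f u - (c + A u)) \<le> \<eta> * \<rho>; \<psi> (f ` U) \<le> ennreal l * \<psi> U\<rbrakk>
        \<Longrightarrow> finite_net (K * l + 2 * \<eta>) (A ` sphere 0 1)"
      using finite_net_derivative_sphere[OF \<psi> A.linear] by metis
    show "completely_continuous A"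
    proof (rule completely_continuous_if_finite_net_sphere[OF A.bounded_linear_axioms])
      fix e :: real
      assume "e > 0"
      \<comment> \<open>The final radius splits as
        \<open>K * (e / (2 * K)) + 2 * (e / 4) = e\<close>.\<close>
      then have "\<forall>\<^sub>F r in at 0 within {0..r1}. dist (l r) 0 < e / (2 * K)"
        using K by (intro tendstoD[OF lim]) simp
      then obtain s where s: "s > 0" "\<And>r. r \<in> {0..r1} \<Longrightarrow> r \<noteq> 0 \<Longrightarrow> \<bar>r\<bar> < s \<Longrightarrow> \<bar>l r\<bar> < e / (2 * K)"
        unfolding eventually_at by (auto simp: dist_real_def)
      obtain d where d: "d > 0" "\<And>\<rho> u. 0 < \<rho> \<Longrightarrow> \<rho> < d \<Longrightarrow> u \<in> U \<rho> \<Longrightarrow>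
          norm (f u - ((f a - A a) + A u)) \<le> e / 4 * \<rho>"
        using close[of "e / 4"] \<open>e > 0\<close> by auto
      \<comment> \<open>Halving puts \<open>r\<close> strictly below all three bounds. The set used
        is \<open>U (r / 2)\<close>, since the radius must lie strictly below the argument of
        \<open>l\<close>.\<close>
      define r where "r = min r1 (min s d) / 2"
      have r: "0 < r" "r < r1" "r < s" "r < d"
        using r1 s(1) d(1) by (auto simp: r_def min_def)
      have "finite_net (K * l r + 2 * (e / 4)) (A ` sphere 0 1)"
      proof (rule net)
        show "norm (f u - ((f a - A a) + A u)) \<le> e / 4 * (r / 2)" if "u \<in> U (r / 2)" for u
          using d(2)[OF _ _ that] r by simp
        show "\<psi> (f ` U (r / 2)) \<le> ennreal (l r) * \<psi> (U (r / 2))"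
          using cond r by simp
        show "sphere a (r / 2) \<subseteq> U (r / 2)" "U (r / 2) \<subseteq> cball a (r / 2)"
          using U r by simp_all
      qed (use r l0 \<open>e > 0\<close> in auto)
      moreover have "K * l r + 2 * (e / 4) \<le> e"
        using order_le_less_trans[OF abs_ge_self s(2)[of r]] r K by (simp add: field_simps)
      ultimately show "finite_net e (A ` sphere 0 1)"
        using finite_net_mono by blast
    qed
  qed
qed

text \<open>The scheme is that of a point, with centre and constant term 0. Two radii occur: the
  outer one \<open>R\<close> sets the scale of the error, while the inner one keeps
  \<open>U r R\<close> in the region where the asymptotic approximation holds and is the argument of
  \<open>l\<close>.\<close>

lemma completely_continuous_asymptotic_derivative_iff:
  fixes f :: "'a::banach \<Rightarrow> 'a"
  assumes \<psi>: "equivalent_mnc \<psi>" and f: "continuous_on UNIV f" and A: "has_asymptotic_derivative f A"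
    and U: "\<And>r R. 0 < r \<Longrightarrow> r < R \<Longrightarrow> sphere 0 R \<subseteq> U r R"
      "\<And>r R. 0 < r \<Longrightarrow> r < R \<Longrightarrow> U r R \<subseteq> cball 0 R - cball 0 r"
  shows "completely_continuous A \<longleftrightarrow> (\<exists>Rf > 0. \<exists>l :: real \<Rightarrow> real.
        (\<forall>R\<ge>Rf. l R \<ge> 0) \<and> (l \<longlongrightarrow> 0) at_top \<and>
        (\<forall>R1 R2. Rf < R1 \<and> R1 < R2 \<longrightarrow> \<psi> (f ` U R1 R2) \<le> ennreal (l R1) * \<psi> (U R1 R2)))"
    (is "_ \<longleftrightarrow> ?R")
proof -
  interpret A: bounded_linear A
    using A unfolding has_asymptotic_derivative_def by blast
  have U': "U r R \<subseteq> cball 0 R" if "0 < r" "r < R" for r R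
    using U(2)[OF that] by blast
  have close: "\<exists>d>0. \<forall>r R u. d < r \<and> r < R \<and> u \<in> U r R \<longrightarrow> norm (f u - (0 + A u)) \<le> \<eta> * R"
    if \<eta>: "\<eta> > 0" for \<eta>
  proof -
    have "\<forall>\<^sub>F u in at_infinity. dist (norm (f u - A u) / norm u) 0 < \<eta>"
      using A \<eta> unfolding has_asymptotic_derivative_def by (intro tendstoD) auto
    then obtain b where b: "\<And>u. b \<le> norm u \<Longrightarrow> norm (f u - A u) / norm u < \<eta>"
      unfolding eventually_at_infinity by auto
    \<comment> \<open>The bound 1 keeps \<open>norm u\<close> positive, so that the quotient can be
      cleared.\<close>
    have "norm (f u - (0 + A u)) \<le> \<eta> * R" if "max b 1 < r" "r < R" "u \<in> U r R" for r R u
    proof -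
      have u: "norm u \<le> R" "r < norm u"
        using U(2)[of r R] that by auto
      have "norm (f u - A u) \<le> \<eta> * norm u"
        using b[of u] u that(1) pos_divide_less_eq[of "norm u"] by force
      also have "\<dots> \<le> \<eta> * R"
        using u(1) \<eta> by simp
      finally show ?thesis
        by simp
    qed
    then show ?thesis
      by (intro exI[of _ "max b 1"]) auto
  qed
  show ?thesis
  proof
    assume "completely_continuous A"
    then obtain K where K: "K > 0"
      and cond: "\<And>f a c \<rho> \<eta> U. \<lbrakk>continuous_on UNIV f; 0 < \<rho>; 0 \<le> \<eta>; sphere a \<rho> \<subseteq> U; U \<subseteq> cball a \<rho>;
        \<And>u. u \<in> U \<Longrightarrow> norm (f u - (c + A u)) \<le> \<eta> * \<rho>\<rbrakk> \<Longrightarrow> \<psi> (f ` U) \<le> ennreal (K * \<eta>) * \<psi> U"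
      using condensing_if_completely_continuous[OF \<psi>] by metis
    define P where "P r e \<longleftrightarrow> (\<forall>R>r. \<psi> (f ` U r R) \<le> ennreal e * \<psi> (U r R))" for r e
    have ex: "\<exists>d>0. \<forall>r>d. P r e" if "e > 0" for e
    proof -
      obtain d where d: "d > 0" "\<And>r R u. d < r \<Longrightarrow> r < R \<Longrightarrow> u \<in> U r R \<Longrightarrow>
          norm (f u - (0 + A u)) \<le> e / K * R"
        using close[of "e / K"] \<open>e > 0\<close> K by auto
      have "\<psi> (f ` U r R) \<le> ennreal e * \<psi> (U r R)" if "d < r" "r < R" for r R
      proof -
        have "0 < r" "0 < R"
          using that d(1) by auto
        then show ?thesis
          using cond[OF f _ _ U(1) U' d(2)[OF that]] that \<open>e > 0\<close> K by simp
      qed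
      then show ?thesis
        using d(1) unfolding P_def by blast
    qed
    obtain Rf where Rf: "Rf > 0" "\<forall>r>Rf. P r 1"
      using ex[of 1] by auto
    \<comment> \<open>Here \<open>inverse\<close> is the summand that is positive for
      \<open>r > 0\<close> and vanishes in the limit.\<close>
    obtain l where l: "\<And>r. l r \<ge> 0" "(l \<longlongrightarrow> 0) at_top"
      "\<And>r. inverse r > 0 \<Longrightarrow> P r 1 \<Longrightarrow> P r (l r)"
    proof (rule comparison_function[of P at_top "inverse :: real \<Rightarrow> real"])
      show "P r e'" if "P r e" "e \<le> e'" for r e e'
        using that unfolding P_def by (meson ennreal_leI mult_right_mono order_trans zero_le)
      show "\<forall>\<^sub>F r in at_top. P r e" if "e > 0" for e
        using ex[OF that] unfolding eventually_at_top_dense by blast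
      show "((inverse :: real \<Rightarrow> real) \<longlongrightarrow> 0) at_top"
        by (rule tendsto_inverse_0_at_top[OF filterlim_ident])
    qed blast
    have "\<psi> (f ` U R1 R2) \<le> ennreal (l R1) * \<psi> (U R1 R2)" if "Rf < R1" "R1 < R2" for R1 R2
      using l(3)[of R1] Rf that unfolding P_def by auto
    then show ?R
      using Rf(1) l(1,2) by blast
  next
    assume ?R
    then obtain Rf l where Rf: "Rf > 0" and l0: "\<And>R. R \<ge> Rf \<Longrightarrow> l R \<ge> 0"
      and lim: "(l \<longlongrightarrow> 0) at_top"
      and cond: "\<And>R1 R2. Rf < R1 \<Longrightarrow> R1 < R2 \<Longrightarrow> \<psi> (f ` U R1 R2) \<le> ennreal (l R1) * \<psi> (U R1 R2)"
      by blast
    obtain K where K: "K > 0"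
      and net: "\<And>f a c \<rho> \<eta> l U. \<lbrakk>0 < \<rho>; 0 < \<eta>; 0 \<le> l; sphere a \<rho> \<subseteq> U; U \<subseteq> cball a \<rho>;
        \<And>u. u \<in> U \<Longrightarrow> norm (f u - (c + A u)) \<le> \<eta> * \<rho>; \<psi> (f ` U) \<le> ennreal l * \<psi> U\<rbrakk>
        \<Longrightarrow> finite_net (K * l + 2 * \<eta>) (A ` sphere 0 1)"
      using finite_net_derivative_sphere[OF \<psi> A.linear] by metis
    show "completely_continuous A"
    proof (rule completely_continuous_if_finite_net_sphere[OF A.bounded_linear_axioms])
      fix e :: real
      assume "e > 0"
      then have "\<forall>\<^sub>F r in at_top. dist (l r) 0 < e / (2 * K)"
        using K by (intro tendstoD[OF lim]) simp
      then obtain s where s: "\<And>r. r > s \<Longrightarrow> \<bar>l r\<bar> < e / (2 * K)"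
        unfolding eventually_at_top_dense by auto
      obtain d where d: "d > 0" "\<And>r R u. d < r \<Longrightarrow> r < R \<Longrightarrow> u \<in> U r R \<Longrightarrow>
          norm (f u - (0 + A u)) \<le> e / 4 * R"
        using close[of "e / 4"] \<open>e > 0\<close> by auto
      \<comment> \<open>Adding 1 makes \<open>r\<close> strictly larger than all three thresholds;
        \<open>2 * r\<close> then serves as an outer radius.\<close>
      define r where "r = max Rf (max s d) + 1"
      have r: "0 < r" "r > Rf" "r > s" "r > d"
        using Rf d(1) by (auto simp: r_def)
      have "finite_net (K * l r + 2 * (e / 4)) (A ` sphere 0 1)"
      proof (rule net)
        show "norm (f u - (0 + A u)) \<le> e / 4 * (2 * r)" if "u \<in> U r (2 * r)" for u
          using d(2)[OF _ _ that] r by simp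
        show "\<psi> (f ` U r (2 * r)) \<le> ennreal (l r) * \<psi> (U r (2 * r))"
          using cond r by simp
        show "sphere 0 (2 * r) \<subseteq> U r (2 * r)" "U r (2 * r) \<subseteq> cball 0 (2 * r)"
          using U(1) U' r by auto
      qed (use r l0 \<open>e > 0\<close> in auto)
      moreover have "K * l r + 2 * (e / 4) \<le> e"
        using order_le_less_trans[OF abs_ge_self s[of r]] r K by (simp add: field_simps)
      ultimately show "finite_net e (A ` sphere 0 1)"
        using finite_net_mono by blast
    qed
  qed
qed

theorem theorem2:
  fixes \<psi> :: "'a::banach set \<Rightarrow> ennreal"
  assumes "equivalent_mnc \<psi>"
  shows
    "(\<forall>(f :: 'a \<Rightarrow> 'a) u1 f'.
        continuous_on UNIV f \<and> (f has_derivative f') (at u1) \<longrightarrow>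
          (completely_continuous f' \<longleftrightarrow> loc_strongly_condensing \<psi> f u1) \<and>
          (loc_strongly_condensing \<psi> f u1 \<longleftrightarrow> loc_strongly_condensing_on_spheres \<psi> f u1))
     \<and>
     (\<forall>(f :: 'a \<Rightarrow> 'a) f'.
        continuous_on UNIV f \<and> has_asymptotic_derivative f f' \<longrightarrow>
          (completely_continuous f' \<longleftrightarrow> strongly_condensing_at_infinity_on_interlayers \<psi> f) \<and>
          (strongly_condensing_at_infinity_on_interlayers \<psi> f \<longleftrightarrow>
             strongly_condensing_at_infinity_on_spheres \<psi> f))"
proof (intro conjI allI impI; elim conjE)
  fix f f' :: "'a \<Rightarrow> 'a" and u1
  assume f: "continuous_on UNIV f" "(f has_derivative f') (at u1)"
  \<comment> \<open>Unification with the unfolded definition determines the family \<open>U\<close>,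
    here the closed balls. Condensing on balls and on spheres are compared only through complete
    continuity of \<open>f'\<close>.\<close>
  have ball: "completely_continuous f' \<longleftrightarrow> loc_strongly_condensing \<psi> f u1"
    unfolding loc_strongly_condensing_def
    by (rule completely_continuous_derivative_iff[OF assms f]) auto
  have sphere: "completely_continuous f' \<longleftrightarrow> loc_strongly_condensing_on_spheres \<psi> f u1"
    unfolding loc_strongly_condensing_on_spheres_def
    by (rule completely_continuous_derivative_iff[OF assms f]) auto
  show "completely_continuous f' \<longleftrightarrow> loc_strongly_condensing \<psi> f u1"
    by (fact ball)
  show "loc_strongly_condensing \<psi> f u1 \<longleftrightarrow> loc_strongly_condensing_on_spheres \<psi> f u1"
    using ball sphere by blast
next
  fix f f' :: "'a \<Rightarrow> 'a"
  assume f: "continuous_on UNIV f" "has_asymptotic_derivative f f'"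
  have layer: "completely_continuous f' \<longleftrightarrow> strongly_condensing_at_infinity_on_interlayers \<psi> f"
    unfolding strongly_condensing_at_infinity_on_interlayers_def
    by (rule completely_continuous_asymptotic_derivative_iff[OF assms f]) auto
  \<comment> \<open>Here \<open>U R1 R2\<close> is \<open>sphere 0 R2\<close>, a family constant in
    the inner radius.\<close>
  have sphere: "completely_continuous f' \<longleftrightarrow> strongly_condensing_at_infinity_on_spheres \<psi> f"
    unfolding strongly_condensing_at_infinity_on_spheres_def
    by (rule completely_continuous_asymptotic_derivative_iff[OF assms f]) auto
  show "completely_continuous f' \<longleftrightarrow> strongly_condensing_at_infinity_on_interlayers \<psi> f"
    by (fact layer)
  show "strongly_condensing_at_infinity_on_interlayers \<psi> f \<longleftrightarrow>
      strongly_condensing_at_infinity_on_spheres \<psi> f"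
    using layer sphere by blast
qed

end
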